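(* For integers $n\ge k\ge2$, let \[ \mathfrak{S}_1(n,k)=S^2(n,k-1)-S(n,k-2)S(n,k). \] Then for any fixed integers $n\ge k\ge 2$, the infinite sequence $\{\mathfrak{S}_1(n+m,k+m)\}_{m\ge0}$ is strictly increasing in $m$.
   Context: $S(n,k)$ denotes the Stirling number of the second kind, i.e. the number of ways to partition an $n$-element set into $k$ nonempty subsets; equivalently $S(n,k)=\frac1{k!}\sum_{i=0}^k(-1)^i\binom{k}{i}(k-i)^n$. In particular $S(0,0)=1$ and $S(n,0)=0$ for $n\ge1$. $S^2(n,k)$ means $(S(n,k))^2$. *)

theory Defs
  imports Complex_Main "HOL-Combinatorics.Stirling"
begin

text \<open>
  The difference is taken in the integers, since subtraction on the natural numbers truncates.
  The index subtractions are on natural numbers and are meant for \<open>k \<ge> 2\<close>,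
  where they do not truncate.
\<close>

definition frakS1 :: "nat \<Rightarrow> nat \<Rightarrow> int" where
  "frakS1 n k = (int (Stirling n (k - 1)))\<^sup>2 - int (Stirling n (k - 2)) * int (Stirling n k)"

end

theory Submission
  imports Defs
begin

text \<open>
  Write \<open>a\<^sub>j = S(n,j)\<close> and \<open>j = k - 1\<close>. Expanding with the recurrence of the Stirling numbers gives
  \<open>\<SS>\<^sub>1(n+1,k+1) - \<SS>\<^sub>1(n,k) = (j+2)(a\<^sub>ja\<^sub>j\<^sub>+\<^sub>1 - a\<^sub>j\<^sub>-\<^sub>1a\<^sub>j\<^sub>+\<^sub>2) + j(j+2)(a\<^sub>j\<^sub>+\<^sub>1\<^sup>2 - a\<^sub>ja\<^sub>j\<^sub>+\<^sub>2) + a\<^sub>j\<^sub>+\<^sub>1\<^sup>2\<close>.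
  The first two terms are nonnegative by log-concavity of \<open>a\<close> in the form
  \<open>a\<^sub>ia\<^sub>l\<^sub>+\<^sub>2 \<le> a\<^sub>i\<^sub>+\<^sub>1a\<^sub>l\<^sub>+\<^sub>1\<close> for \<open>i \<le> l\<close>, and \<open>a\<^sub>j\<^sub>+\<^sub>1 > 0\<close> because \<open>k \<le> n\<close>.
\<close>

lemma Stirling_pos:
  assumes "0 < k" and "k \<le> n"
  shows "0 < Stirling n k"
  using assms
proof (induction n arbitrary: k)
  case (Suc n)
  then obtain j where "k = Suc j" by (cases k) auto
  with Suc show ?case
    by (cases "j = 0") (simp_all only: Stirling_1, auto)
qed simp

text \<open>Quantifying over all pairs \<open>i \<le> l\<close> rather than only \<open>i = l\<close> spares a division:
  the case \<open>l = i + 1\<close> would otherwise need the positivity of the middle entries.\<close>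

lemma Stirling_log_concave:
  assumes "i \<le> l"
  shows "Stirling n i * Stirling n (l + 2) \<le> Stirling n (i + 1) * Stirling n (l + 1)"
  using assms
proof (induction n arbitrary: i l)
  case (Suc n)
  show ?case
  proof (cases i)
    case (Suc p)
    with Suc.prems obtain d where l: "l = p + 1 + d"
      by (auto simp: le_iff_add)
    define s where "s = Stirling n"
    \<comment> \<open>The recurrence expands both sides into these products of entries of row
      \<open>n\<close>, which are then compared group by group.\<close>
    define u v w x y z
      where "u = s (p + 1) * s (l + 2)" and "v = s (p + 2) * s (l + 1)"
        and "w = s p * s (l + 2)" and "x = s (p + 1) * s (l + 1)"
        and "y = s (p + 2) * s l" and "z = s (p + 1) * s l"
    have uv: "u \<le> v"
      using Suc.IH[of "p + 1" l] l by (simp add: u_def v_def s_def)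
    have wx: "w \<le> x"
      using Suc.IH[of p l] l by (simp add: w_def x_def s_def)
    \<comment> \<open>For \<open>d = 0\<close> both sides agree; otherwise the induction hypothesis
      applies to the pair \<open>p + 1\<close>, \<open>l - 1\<close>.\<close>
    have xy: "x \<le> y"
    proof (cases d)
      case 0
      then show ?thesis by (simp add: x_def y_def l)
    next
      case (Suc q)
      then show ?thesis
        using Suc.IH[of "p + 1" "p + 1 + q"] by (simp add: x_def y_def s_def l)
    qed
    have tz: "s p * s (l + 1) \<le> z"
      using Suc.IH[of p "p + d"] by (simp add: z_def s_def l)
    \<comment> \<open>The coefficients compare because \<open>p \<le> l\<close>.\<close>
    have "(p + 1) * (l + 2) * u \<le> (p + 2) * (l + 1) * v"
      by (intro mult_le_mono[OF _ uv]) (simp add: l)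
    moreover have "(p + 1) * x + (l + 2) * w \<le> (p + 2) * y + (l + 1) * x"
    proof -
      have "(p + 1) * x + (l + 2) * w \<le> (p + 1) * x + (l + 2) * x"
        using wx by (intro add_left_mono mult_left_mono) auto
      also have "\<dots> = (p + 2) * x + (l + 1) * x"
        by (simp add: algebra_simps)
      also have "\<dots> \<le> (p + 2) * y + (l + 1) * x"
        using xy by (intro add_right_mono mult_left_mono) auto
      finally show ?thesis .
    qed
    moreover have "Stirling (Suc n) i * Stirling (Suc n) (l + 2)
        = (p + 1) * (l + 2) * u + ((p + 1) * x + (l + 2) * w) + s p * s (l + 1)"
      by (simp add: Suc u_def w_def x_def s_def algebra_simps)
    moreover have "Stirling (Suc n) (i + 1) * Stirling (Suc n) (l + 1)
        = (p + 2) * (l + 1) * v + ((p + 2) * y + (l + 1) * x) + z"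
      by (simp add: Suc v_def x_def y_def z_def s_def algebra_simps)
    ultimately show ?thesis
      using tz by linarith
  qed simp
qed simp

text \<open>Starting from \<open>i = k - 2\<close> keeps index subtraction out of the algebra; here
  \<open>j = i + 1\<close>, so \<open>a r\<close> is the entry at \<open>j - 1 + r\<close>.\<close>

lemma frakS1_diff:
  fixes n i :: nat
  defines "a \<equiv> \<lambda>r. int (Stirling n (i + r))"
  shows "frakS1 (Suc n) (i + 3) - frakS1 n (i + 2) =
    (int i + 3) * (a 1 * a 2 - a 0 * a 3) + (int i + 1) * (int i + 3) * (a 2 * a 2 - a 1 * a 3)
    + (a 2)\<^sup>2"
  by (simp add: frakS1_def a_def numeral_eq_Suc algebra_simps)

theorem theorem4p1:
  fixes n k :: nat
  assumes "2 \<le> k" and "k \<le> n"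
  shows "strict_mono (\<lambda>m::nat. frakS1 (n + m) (k + m))"
unfolding strict_mono_Suc_iff
proof
  fix m
  obtain i where i: "k + m = i + 2"
    using assms(1) by (metis add.commute le_iff_add trans_le_add1)
  define N where "N = n + m"
  define a where "a r = int (Stirling N (i + r))" for r
  have "0 \<le> a 1 * a 2 - a 0 * a 3"
    using Stirling_log_concave[of i "i + 1" N]
    by (simp add: a_def numeral_eq_Suc flip: of_nat_mult)
  moreover have "0 \<le> a 2 * a 2 - a 1 * a 3"
    using Stirling_log_concave[of "i + 1" "i + 1" N]
    by (simp add: a_def numeral_eq_Suc flip: of_nat_mult)
  moreover have "0 < a 2"
    using Stirling_pos[of "i + 2" N] assms(2) i by (simp add: a_def N_def)
  ultimately have "0 < (int i + 3) * (a 1 * a 2 - a 0 * a 3)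
      + (int i + 1) * (int i + 3) * (a 2 * a 2 - a 1 * a 3) + (a 2)\<^sup>2"
    by (intro add_nonneg_pos add_nonneg_nonneg mult_nonneg_nonneg) auto
  then have "frakS1 N (i + 2) < frakS1 (Suc N) (i + 3)"
    using frakS1_diff[of N i] by (simp add: a_def)
  moreover have "k + Suc m = i + 3"
    using i by simp
  ultimately show "frakS1 (n + m) (k + m) < frakS1 (n + Suc m) (k + Suc m)"
    by (metis N_def add_Suc_right i)
qed

end
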